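(* Let $k$ be a field, let $(A,\alpha,t)$ be a $d$-dimensional monogenic Frobenius algebra over $k$ ($d\geq 1$), let $q\in k[T]$ be the (monic, degree $d$) minimal polynomial of $\alpha$, and let $p\in k[T]$ be the polynomial of degree less than $d$, coprime to $q$, such that $\sum_{\ell\geq 0}t(\alpha^\ell)T^{-\ell-1}=p/q$ in $k((T^{-1}))$. Let $r\in k[T]$ be the polynomial of degree less than $d$ such that $rp\equiv 1 \bmod q$. Then $$B^\#=B(q,r),$$ or, equivalently, the Casimir element $C$ of $(A,t)$ is $$C=\frac{q(x)r(y)-q(y)r(x)}{x-y}.$$
   Context: A monogenic Frobenius algebra over $k$ is a triple $(A,\alpha,t)$, where $A$ is a finite dimensional commutative $k$-algebra with unit, $A=k[\alpha]$, and $t\colon A\to k$ is a $k$-linear map such that $\langle x,y\rangle:=t(xy)$ is a non-degenerate bilinear form on $A$. For such an algebra of dimension $d$ the power series $\sum_{\ell\ge0}t(\alpha^\ell)T^{-\ell-1}$ is the expansion at $\infty$ of a rational function $p/q$ in lowest terms with $q$ the minimal polynomial of $\alpha$ and $\deg p<d$. The Casimir element of $(A,t)$ is $C:=\sum_{i=1}^d e_i\otimes e_i^\#\in A\otimes_k A$, where $e_1,\dots,e_d$ is any basis of $A$ and $e_1^\#,\dots,e_d^\#$ is its dual basis, i.e. $\langle e_i,e_j^\#\rangle=\delta_{i,j}$; it does not depend on the basis. Elements of $A\otimes_k A$ are represented by polynomials in $k[x,y]$ of degree at most $d-1$ in each variable, $x$ standing for $\alpha\otimes 1$ and $y$ for $1\otimes\alpha$.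 Take $e_i:=\alpha^{i-1}$ for $i=1,\dots,d$. Then $B^\#$ is the $d\times d$ matrix $(b^\#_{i,j})$ with $b^\#_{i,j}:=\langle e_i^\#,e_j^\#\rangle$. For polynomials $f,g\in k[T]$ with $n:=\max\{\deg f,\deg g\}$, the classical Bezoutian is the symmetric $n\times n$ matrix $B(f,g)=(b_{i,j})$ defined by $$\frac{f(x)g(y)-f(y)g(x)}{x-y}=\sum_{i,j=1}^{n} b_{i,j}\,x^{i-1}y^{j-1}.$$ *)

theory Defs
  imports
    "HOL-Computational_Algebra.Formal_Laurent_Series"
    "HOL-Number_Theory.Cong"
    "HOL-Library.Poly_Mapping"
    "Jordan_Normal_Form.Matrix"
begin

section \<open>Monogenic Frobenius algebras\<close>

definition eval_alg :: "('k::field \<Rightarrow> 'a::comm_ring_1 \<Rightarrow> 'a) \<Rightarrow> 'a \<Rightarrow> 'k poly \<Rightarrow> 'a" where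
  "eval_alg scale a f = (\<Sum>i\<le>degree f. scale (coeff f i) (a ^ i))"

text \<open>The algebra is the whole type \<open>'a\<close>. As multiplication is commutative, the form
  \<open>t (x * y)\<close> is symmetric, so one-sided non-degeneracy suffices.\<close>

locale monogenic_frobenius_algebra = vector_space scale
  for scale :: "'k::field \<Rightarrow> 'a::comm_ring_1 \<Rightarrow> 'a" +
  fixes \<alpha> :: 'a and t :: "'a \<Rightarrow> 'k"
  assumes scale_mult_left: "scale c x * y = scale c (x * y)"
    and finite_dim: "\<exists>B. finite B \<and> span B = UNIV"
    and monogenic: "range (eval_alg scale \<alpha>) = UNIV"
    and linear_t: "Vector_Spaces.linear scale (*) t"
    and nondegenerate: "(\<And>y. t (x * y) = 0) \<Longrightarrow> x = 0"

definition is_min_poly :: "('k::field \<Rightarrow> 'a::comm_ring_1 \<Rightarrow> 'a) \<Rightarrow> 'a \<Rightarrow> 'k poly \<Rightarrow> bool" where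
  "is_min_poly scale a q \<longleftrightarrow> lead_coeff q = 1 \<and> eval_alg scale a q = 0 \<and>
     (\<forall>f. f \<noteq> 0 \<longrightarrow> eval_alg scale a f = 0 \<longrightarrow> degree q \<le> degree f)"

text \<open>\<open>k((T\<^sup>-\<^sup>1))\<close> is \<open>'k fls\<close> with \<open>fls_X\<close> in the role of \<open>T\<^sup>-\<^sup>1\<close>, so \<open>T\<close> is \<open>fls_X_inv\<close>.\<close>

definition poly_at_infinity :: "'k::field poly \<Rightarrow> 'k fls" where
  "poly_at_infinity f = poly (map_poly fls_const f) fls_X_inv"

definition moment_series :: "('a::comm_ring_1 \<Rightarrow> 'k::field) \<Rightarrow> 'a \<Rightarrow> 'k fls" where
  "moment_series t a = fps_to_fls (fps_X * Abs_fps (\<lambda>l. t (a ^ l)))"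

section \<open>Dual bases\<close>

text \<open>All indices are shifted to start at \<open>0\<close>.\<close>

definition basis_family ::
    "('k::field \<Rightarrow> 'a::comm_ring_1 \<Rightarrow> 'a) \<Rightarrow> nat \<Rightarrow> (nat \<Rightarrow> 'a) \<Rightarrow> bool" where
  "basis_family scale d e \<longleftrightarrow> inj_on e {..<d} \<and>
     \<not> module.dependent scale (e ` {..<d}) \<and> module.span scale (e ` {..<d}) = UNIV"

definition dual_family ::
    "('a::comm_ring_1 \<Rightarrow> 'k::field) \<Rightarrow> nat \<Rightarrow> (nat \<Rightarrow> 'a) \<Rightarrow> nat \<Rightarrow> 'a" where
  "dual_family t d e j = (THE y. \<forall>i<d. t (e i * y) = (if i = j then 1 else 0))"

definition dual_gram :: "('a::comm_ring_1 \<Rightarrow> 'k::field) \<Rightarrow> nat \<Rightarrow> (nat \<Rightarrow> 'a) \<Rightarrow> 'k mat" where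
  "dual_gram t d e = mat d d (\<lambda>(i, j). t (dual_family t d e i * dual_family t d e j))"

lemma (in monogenic_frobenius_algebra) ex1_dual:
  assumes e: "basis_family scale d e" and j: "j < d"
  shows "\<exists>!y. \<forall>i<d. t (e i * y) = (if i = j then 1 else 0)"
proof -
  let ?B = "e ` {..<d}"
  have inj: "inj_on e {..<d}" and ind: "independent ?B" and sp: "span ?B = UNIV"
    using e by (auto simp: basis_family_def)
  interpret T: Vector_Spaces.linear scale "(*)" t by (fact linear_t)
  interpret F: finite_dimensional_vector_space scale ?B
    by unfold_locales (use ind sp in auto)
  define \<phi> where "\<phi> y = (\<Sum>i<d. scale (t (e i * y)) (e i))" for y
  have coeffs: "\<forall>i<d. f i = g i"
    if "(\<Sum>i<d. scale (f i) (e i)) = (\<Sum>i<d. scale (g i) (e i))" for f g :: "nat \<Rightarrow> 'k"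
  proof (intro allI impI)
    fix i assume i: "i < d"
    define u where "u v = f (inv_into {..<d} e v) - g (inv_into {..<d} e v)" for v
    have "(\<Sum>i<d. scale (f i - g i) (e i)) = 0"
      using that by (simp add: scale_left_diff_distrib sum_subtractf)
    moreover have "(\<Sum>v\<in>?B. scale (u v) v) = (\<Sum>i<d. scale (f i - g i) (e i))"
      by (simp add: sum.reindex[OF inj] inj u_def)
    ultimately have "(\<Sum>v\<in>?B. scale (u v) v) = 0"
      by simp
    then have "u (e i) = 0"
      using independentD[OF ind _ subset_refl, of u "e i"] i by simp
    then show "f i = g i" using i inj by (simp add: u_def)
  qed
  have smr: "x * scale c y = scale c (x * y)" for x y c
    by (metis mult.commute scale_mult_left)
  have lin: "Vector_Spaces.linear scale scale \<phi>"
    by unfold_locales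
      (simp_all add: \<phi>_def ring_distribs T.add T.scale smr scale_left_distrib
        sum.distrib scale_sum_right)
  have zero: "y = 0" if "\<forall>i<d. t (e i * y) = 0" for y
  proof (rule nondegenerate)
    fix z
    have "z \<in> span ?B" using sp by simp
    then show "t (y * z) = 0"
    proof (induction rule: span_induct_alt)
      case base
      then show ?case by (simp add: T.zero)
    next
      case (step c x z)
      then show ?case using that by (auto simp: ring_distribs T.add T.scale smr mult.commute)
    qed
  qed
  have unique: "y = z" if "\<forall>i<d. t (e i * y) = t (e i * z)" for y z
    using zero[of "y - z"] that by (simp add: right_diff_distrib T.diff)
  have "inj \<phi>"
    by (rule injI, rule unique, rule coeffs) (simp add: \<phi>_def)
  then have "surj \<phi>"
    by (rule F.linear_inj_imp_surj[OF lin])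
  then obtain y where "\<phi> y = e j" by (metis surjD)
  then have "(\<Sum>i<d. scale (t (e i * y)) (e i)) = (\<Sum>i<d. scale (if i = j then 1 else 0) (e i))"
    using j by (simp add: \<phi>_def if_distrib[of "\<lambda>c. scale c _"] cong: if_cong)
  then have "\<forall>i<d. t (e i * y) = (if i = j then 1 else 0)" by (rule coeffs)
  then show ?thesis using unique by (intro ex1I[of _ y]) auto
qed

section \<open>The tensor square\<close>

text \<open>\<open>A \<otimes>\<^sub>k A\<close> is the free \<open>k\<close>-vector space on the pairs \<open>(a, b)\<close> modulo the bilinearity
  relations; its elements are the cosets \<open>tensor_class scale u\<close>.\<close>

definition free_scale :: "'k::field \<Rightarrow> ('b \<Rightarrow>\<^sub>0 'k) \<Rightarrow> ('b \<Rightarrow>\<^sub>0 'k)" where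
  "free_scale c = Poly_Mapping.map ((*) c)"

lemma vector_space_free_scale: "vector_space (free_scale :: 'k::field \<Rightarrow> ('b \<Rightarrow>\<^sub>0 'k) \<Rightarrow> _)"
proof -
  have *: "poly_mapping.lookup (free_scale c u) x = c * poly_mapping.lookup u x"
    for c :: 'k and u :: "'b \<Rightarrow>\<^sub>0 'k" and x
    unfolding free_scale_def by transfer (simp add: when_def)
  show ?thesis
    by (rule vector_space.intro; rule poly_mapping_eqI)
      (simp_all only: * lookup_add distrib_left distrib_right mult.assoc mult_1_left)
qed

abbreviation free_gen :: "'a \<Rightarrow> 'a \<Rightarrow> ('a \<times> 'a) \<Rightarrow>\<^sub>0 'k::field" where
  "free_gen a b \<equiv> Poly_Mapping.single (a, b) 1"

inductive_set tensor_relations ::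
    "('k::field \<Rightarrow> 'a::comm_ring_1 \<Rightarrow> 'a) \<Rightarrow> (('a \<times> 'a) \<Rightarrow>\<^sub>0 'k) set"
  for scale :: "'k \<Rightarrow> 'a \<Rightarrow> 'a" where
  add_left: "free_gen (a + a') b - free_gen a b - free_gen a' b \<in> tensor_relations scale"
| add_right: "free_gen a (b + b') - free_gen a b - free_gen a b' \<in> tensor_relations scale"
| scale_left: "free_gen (scale c a) b - free_scale c (free_gen a b) \<in> tensor_relations scale"
| scale_right: "free_gen a (scale c b) - free_scale c (free_gen a b) \<in> tensor_relations scale"

definition tensor_class ::
    "('k::field \<Rightarrow> 'a::comm_ring_1 \<Rightarrow> 'a) \<Rightarrow> (('a \<times> 'a) \<Rightarrow>\<^sub>0 'k) \<Rightarrow> (('a \<times> 'a) \<Rightarrow>\<^sub>0 'k) set" where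
  "tensor_class scale u = {v. v - u \<in> module.span free_scale (tensor_relations scale)}"

definition casimir ::
    "('k::field \<Rightarrow> 'a::comm_ring_1 \<Rightarrow> 'a) \<Rightarrow> ('a \<Rightarrow> 'k) \<Rightarrow> nat \<Rightarrow> (nat \<Rightarrow> 'a) \<Rightarrow>
     (('a \<times> 'a) \<Rightarrow>\<^sub>0 'k) set" where
  "casimir scale t d e = tensor_class scale (\<Sum>i<d. free_gen (e i) (dual_family t d e i))"

section \<open>Polynomials in two variables\<close>

text \<open>\<open>k[x,y]\<close> is \<open>'k poly poly\<close> with \<open>x\<close> the outer and \<open>y\<close> the inner variable: the coefficient
  of \<open>x\<^sup>i y\<^sup>j\<close> in \<open>P\<close> is \<open>coeff (coeff P i) j\<close>.\<close>

definition in_x :: "'k::field poly \<Rightarrow> 'k poly poly" where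
  "in_x f = map_poly (\<lambda>c. [:c:]) f"

definition in_y :: "'k::field poly \<Rightarrow> 'k poly poly" where
  "in_y f = [:f:]"

definition x_minus_y :: "'k::field poly poly" where
  "x_minus_y = in_x [:0, 1:] - in_y [:0, 1:]"

definition bezout_poly :: "'k::field poly \<Rightarrow> 'k poly \<Rightarrow> 'k poly poly" where
  "bezout_poly f g = (in_x f * in_y g - in_y f * in_x g) div x_minus_y"

text \<open>The division is exact.\<close>

lemma bezout_poly_mult: "bezout_poly f g * x_minus_y = in_x f * in_y g - in_y f * in_x g"
proof -
  have [simp]: "poly (in_x h) [:0, 1:] = h" for h :: "'a poly"
    by (induction h) (simp_all add: in_x_def map_poly_pCons)
  have "x_minus_y = [:- [:0, 1:], 1 :: 'a poly:]"
    by (simp add: x_minus_y_def in_x_def in_y_def map_poly_pCons one_pCons)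
  moreover have "[:- [:0, 1:], 1:] dvd in_x f * in_y g - in_y f * in_x g"
    by (subst poly_eq_0_iff_dvd[symmetric]) (simp add: in_y_def)
  ultimately show ?thesis by (simp add: bezout_poly_def)
qed

definition bezoutian :: "'k::field poly \<Rightarrow> 'k poly \<Rightarrow> 'k mat" where
  "bezoutian f g = (let n = max (degree f) (degree g) in
     mat n n (\<lambda>(i, j). coeff (coeff (bezout_poly f g) i) j))"

text \<open>\<open>P\<close> represents \<open>C \<in> A \<otimes>\<^sub>k A\<close>: it has degree at most \<open>d - 1\<close> in each variable, and
  \<open>x \<mapsto> a \<otimes> 1\<close>, \<open>y \<mapsto> 1 \<otimes> a\<close>, so \<open>x\<^sup>i y\<^sup>j \<mapsto> a\<^sup>i \<otimes> a\<^sup>j\<close>, sends it to \<open>C\<close>.\<close>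

definition represents_tensor ::
    "('k::field \<Rightarrow> 'a::comm_ring_1 \<Rightarrow> 'a) \<Rightarrow> 'a \<Rightarrow> nat \<Rightarrow> 'k poly poly \<Rightarrow>
     (('a \<times> 'a) \<Rightarrow>\<^sub>0 'k) set \<Rightarrow> bool" where
  "represents_tensor scale a d P C \<longleftrightarrow>
     degree P \<le> d - 1 \<and> (\<forall>i. degree (coeff P i) \<le> d - 1) \<and>
     C = tensor_class scale
       (\<Sum>i<d. \<Sum>j<d. free_scale (coeff (coeff P i) j) (free_gen (a ^ i) (a ^ j)))"

end

theory Submission
  imports Defs
begin

text \<open>Everything is reduced to the functional \<open>\<tau>(f) = t(f(\<alpha>))\<close> on \<open>k[y]\<close>, which vanishes on the
  multiples of \<open>q\<close>. Let it act on \<open>k[x,y]\<close> through the variable \<open>y\<close>, and write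
  \<open>D\<^sub>f = (f(x) - f(y)) / (x - y)\<close>. Three observations carry the proof.

  First, \<open>\<tau>(D\<^sub>q) = p\<close>: this is the equation \<open>q \<cdot> (\<Sum>\<^sub>l \<tau>(y\<^sup>l) T\<^sup>-\<^sup>l\<^sup>-\<^sup>1) = p\<close>, read off at the
  nonnegative powers of \<open>T\<close> (\<open>numerator_eq_map_difference_quotient\<close>).

  Second, applying \<open>\<tau>\<close> to \<open>(f(x) - f(y)) D\<^sub>q = (q(x) - q(y)) D\<^sub>f\<close> gives
  \<open>\<tau>(f(y) D\<^sub>q) = f p - q \<tau>(D\<^sub>f)\<close>. So multiplying \<open>D\<^sub>q\<close> by \<open>f(y)\<close> multiplies its image by \<open>f\<close>,
  modulo \<open>q\<close> (\<open>map_difference_quotient_product\<close>).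

  Third, the Bezoutian \<open>b(x,y) = (q(x) r(y) - q(y) r(x)) / (x - y)\<close> is \<open>r(y) D\<^sub>q - q(y) D\<^sub>r\<close>, hence
  \<open>\<tau>(f(y) b) \<equiv> f r p \<equiv> f\<close> modulo \<open>q\<close>. For \<open>deg f < d\<close> both sides have degree less than \<open>d\<close>,
  so they are equal (\<open>map_bezout_poly\<close>).

  Taking \<open>f = y\<^sup>j\<close> and comparing coefficients of \<open>x\<^sup>i\<close> says that the coefficients \<open>b\<^sub>i(y)\<close> of \<open>b\<close>,
  evaluated at \<open>\<alpha>\<close>, form the dual basis of the powers of \<open>\<alpha>\<close> (\<open>dual_family_powers\<close>). Expanding
  one factor of \<open>\<langle>b\<^sub>i(\<alpha>), b\<^sub>j(\<alpha>)\<rangle>\<close> in powers of \<open>\<alpha>\<close> yields the Gram matrix, and expanding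
  \<open>\<Sum>\<^sub>i \<alpha>\<^sup>i \<otimes> b\<^sub>i(\<alpha>)\<close> yields the Casimir element for the basis of powers. Any other basis gives
  the same element of the tensor square (\<open>casimir_basis_independent\<close>).\<close>

section \<open>The polynomial Bezoutian\<close>

lemma in_x_pCons: "in_x (pCons a f) = pCons [:a:] (in_x f)"
  by (simp add: in_x_def map_poly_pCons)

lemma in_x_one: "in_x 1 = (1 :: 'k::field poly poly)"
  by (simp add: in_x_def one_pCons map_poly_pCons)

lemma in_y_one: "in_y 1 = (1 :: 'k::field poly poly)"
  by (simp add: in_y_def)

lemma in_y_mult: "in_y (f * g) = in_y f * in_y g"
  by (simp add: in_y_def)

lemma coeff_in_x: "coeff (in_x f) i = [:coeff f i:]"
  by (simp add: in_x_def coeff_map_poly)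

lemma degree_in_x: "degree (in_x f) = degree f"
  by (simp add: in_x_def degree_map_poly)

lemma x_minus_y_eq: "x_minus_y = [:- [:0, 1:], 1 :: 'k::field poly:]"
  by (simp add: x_minus_y_def in_x_def in_y_def map_poly_pCons one_pCons)

lemma mult_x_minus_y: "P * x_minus_y = pCons 0 P - Polynomial.smult [:0, 1:] (P :: 'k::field poly poly)"
  by (simp add: x_minus_y_eq mult.commute[of P] del: minus_pCons)

lemma x_minus_y_nonzero: "x_minus_y \<noteq> (0 :: 'k::field poly poly)"
  by (simp add: x_minus_y_eq)

lemma bezout_poly_eqI:
  assumes "P * x_minus_y = in_x f * in_y g - in_y f * in_x g"
  shows "bezout_poly f g = P"
proof -
  have "bezout_poly f g * x_minus_y = P * x_minus_y"
    using assms by (simp only: bezout_poly_mult)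
  then show ?thesis by (simp only: mult_right_cancel[OF x_minus_y_nonzero])
qed

abbreviation difference_quotient :: "'k::field poly \<Rightarrow> 'k poly poly" where
  "difference_quotient f \<equiv> bezout_poly f 1"

lemma difference_quotient_mult: "difference_quotient f * x_minus_y = in_x f - in_y f"
  using bezout_poly_mult[of f 1] by (simp add: in_x_one in_y_one)

text \<open>Divide \<open>x f(x) - y f(y) = (x - y) f(y) + x (f(x) - f(y))\<close> by \<open>x - y\<close>; in the representation by
  coefficients in \<open>x\<close>, this is a mere \<open>pCons\<close>. The recursion matches the recursion of the
  product with a series at infinity below.\<close>

lemma difference_quotient_pCons:
  "difference_quotient (pCons a f) = pCons f (difference_quotient f)"
proof (rule bezout_poly_eqI)
  have "pCons f (difference_quotient f) * x_minus_y
      = Polynomial.smult f x_minus_y + pCons 0 (difference_quotient f * x_minus_y)"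
    by (simp add: mult_pCons_left)
  also have "\<dots> = in_x (pCons a f) - in_y (pCons a f)"
    by (simp only: difference_quotient_mult) (simp add: x_minus_y_eq in_x_pCons in_y_def)
  finally show "pCons f (difference_quotient f) * x_minus_y
      = in_x (pCons a f) * in_y 1 - in_y (pCons a f) * in_x 1"
    by (simp add: in_x_one in_y_one)
qed

lemma bezout_poly_eq_difference_quotients:
  "bezout_poly f g = in_y g * difference_quotient f - in_y f * difference_quotient g"
proof (rule bezout_poly_eqI)
  have "(in_y g * difference_quotient f - in_y f * difference_quotient g) * x_minus_y
     = in_y g * (difference_quotient f * x_minus_y) - in_y f * (difference_quotient g * x_minus_y)"
    by (simp only: left_diff_distrib mult.assoc)
  also have "\<dots> = in_x f * in_y g - in_y f * in_x g"
    by (simp only: difference_quotient_mult) (simp add: algebra_simps)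
  finally show "(in_y g * difference_quotient f - in_y f * difference_quotient g) * x_minus_y
     = in_x f * in_y g - in_y f * in_x g" .
qed

lemma degree_bezout_poly:
  assumes "degree f \<le> Suc m" and "degree g \<le> Suc m"
  shows "degree (bezout_poly f g) \<le> m"
proof (cases "bezout_poly f g = 0")
  case False
  have "degree (in_x f * in_y g) \<le> Suc m" "degree (in_y f * in_x g) \<le> Suc m"
    using assms degree_mult_le[of "in_x f" "in_y g"] degree_mult_le[of "in_y f" "in_x g"]
    by (auto simp: degree_in_x in_y_def)
  then have "degree (bezout_poly f g * x_minus_y) \<le> Suc m"
    by (simp add: bezout_poly_mult degree_diff_le)
  moreover have "degree (bezout_poly f g * x_minus_y) = degree (bezout_poly f g) + 1"
    using False x_minus_y_nonzero by (subst degree_mult_eq) (simp_all add: x_minus_y_eq)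
  ultimately show ?thesis by simp
qed simp

text \<open>Comparing coefficients of \<open>x\<^sup>i\<close> in \<open>(x - y) b = f(x) g(y) - f(y) g(x)\<close>, with \<open>b\<close> the Bezoutian, expresses \<open>y b\<^sub>i\<close> by
  \<open>b\<^sub>i\<^sub>-\<^sub>1\<close> and a combination of \<open>f(y)\<close> and \<open>g(y)\<close>; so the bound goes up from \<open>b\<^sub>i\<^sub>-\<^sub>1\<close> to \<open>b\<^sub>i\<close>. The
  expression by difference quotients does not give it directly, as the leading terms cancel.\<close>

lemma degree_coeff_bezout_poly:
  assumes f: "degree f \<le> Suc m" and g: "degree g \<le> Suc m"
  shows "degree (coeff (bezout_poly f g) i) \<le> m"
proof -
  let ?P = "bezout_poly f g"
  have step: "pCons 0 (coeff ?P i) = coeff (pCons 0 ?P) i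
      - (Polynomial.smult (coeff f i) g - Polynomial.smult (coeff g i) f)"
    for i
  proof -
    have "coeff (?P * x_minus_y) i = Polynomial.smult (coeff f i) g - Polynomial.smult (coeff g i) f"
      by (simp add: bezout_poly_mult in_y_def coeff_in_x mult.commute[of "in_x f"])
    moreover have "coeff (?P * x_minus_y) i = coeff (pCons 0 ?P) i - pCons 0 (coeff ?P i)"
      by (simp add: mult_x_minus_y)
    ultimately have "coeff (pCons 0 ?P) i - pCons 0 (coeff ?P i)
        = Polynomial.smult (coeff f i) g - Polynomial.smult (coeff g i) f"
      by (simp only:)
    from this[symmetric] show ?thesis by (simp only: diff_diff_eq2 add_diff_cancel_left')
  qed
  have bound: "degree (coeff ?P i) \<le> m" if "degree (coeff (pCons 0 ?P) i) \<le> Suc m" for i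
  proof -
    have "degree (pCons 0 (coeff ?P i)) \<le> Suc m"
      unfolding step[of i]
      by (intro degree_diff_le that order_trans[OF degree_smult_le] f g)
    then show ?thesis by (cases "coeff ?P i = 0") simp_all
  qed
  show ?thesis
    by (induction i) (auto intro!: bound simp: le_SucI)
qed

section \<open>Linear functionals on polynomials\<close>

text \<open>A functional \<open>\<tau>\<close> on \<open>k[y]\<close> extends to a \<open>k[x]\<close>-linear map \<open>k[x,y] \<rightarrow> k[x]\<close>; with \<open>x\<close> as the outer
  variable, this extension is \<open>map_poly \<tau>\<close>.\<close>

locale poly_functional =
  fixes \<tau> :: "'k::field poly \<Rightarrow> 'k"
  assumes add: "\<tau> (f + g) = \<tau> f + \<tau> g"
    and smult: "\<tau> (Polynomial.smult c f) = c * \<tau> f"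
begin

lemma zero: "\<tau> 0 = 0"
  using smult[of 0 0] by simp

lemma diff: "\<tau> (f - g) = \<tau> f - \<tau> g"
  using add[of "f - g" g] by simp

lemma coeff_map: "coeff (map_poly \<tau> P) i = \<tau> (coeff P i)"
  by (simp add: coeff_map_poly zero)

lemma map_add: "map_poly \<tau> (P + Q) = map_poly \<tau> P + map_poly \<tau> Q"
  by (rule poly_eqI) (simp add: coeff_map add)

lemma map_diff: "map_poly \<tau> (P - Q) = map_poly \<tau> P - map_poly \<tau> Q"
  by (rule poly_eqI) (simp add: coeff_map diff)

lemma map_pCons: "map_poly \<tau> (pCons f P) = pCons (\<tau> f) (map_poly \<tau> P)"
  by (simp add: map_poly_pCons zero)

lemma map_in_x_mult: "map_poly \<tau> (in_x f * P) = f * map_poly \<tau> P"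
proof (induction f)
  case 0
  then show ?case by (simp add: in_x_def)
next
  case (pCons a f)
  have "map_poly \<tau> (Polynomial.smult [:a:] P) = Polynomial.smult a (map_poly \<tau> P)"
    by (rule poly_eqI) (simp add: coeff_map smult)
  with pCons show ?case
    by (simp add: in_x_pCons map_add map_pCons zero)
qed

text \<open>Both \<open>(f(x) - f(y)) D\<^sub>q\<close> and \<open>(q(x) - q(y)) D\<^sub>f\<close> are \<open>(x - y) D\<^sub>f D\<^sub>q\<close>. Under \<open>\<tau>\<close>, the factors in
  \<open>x\<close> come out and the term with \<open>q(y)\<close> vanishes.\<close>

lemma map_difference_quotient_product:
  assumes "\<And>g. \<tau> (q * g) = 0"
  shows "map_poly \<tau> (in_y f * difference_quotient q)
    = f * map_poly \<tau> (difference_quotient q) - q * map_poly \<tau> (difference_quotient f)"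
proof -
  have kill: "map_poly \<tau> (in_y q * P) = 0" for P
    by (rule poly_eqI) (simp add: coeff_map in_y_def assms)
  have "in_x f * difference_quotient q - in_y f * difference_quotient q
      = difference_quotient f * x_minus_y * difference_quotient q"
    by (simp only: difference_quotient_mult left_diff_distrib)
  also have "\<dots> = difference_quotient q * x_minus_y * difference_quotient f"
    by (simp only: mult_ac)
  also have "\<dots> = in_x q * difference_quotient f - in_y q * difference_quotient f"
    by (simp only: difference_quotient_mult left_diff_distrib)
  finally have "map_poly \<tau> (in_x f * difference_quotient q - in_y f * difference_quotient q)
      = map_poly \<tau> (in_x q * difference_quotient f - in_y q * difference_quotient f)"
    by (rule arg_cong)
  then have "f * map_poly \<tau> (difference_quotient q) - map_poly \<tau> (in_y f * difference_quotient q)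
      = q * map_poly \<tau> (difference_quotient f)"
    by (simp only: map_diff map_in_x_mult kill diff_zero)
  from this[symmetric] show ?thesis by (simp only: diff_diff_eq2 add_diff_cancel_left')
qed

text \<open>In other words, the Bezoutian \<open>b\<close> of \<open>q\<close> and \<open>r\<close> is the reproducing kernel of the pairing \<open>(f, g) \<mapsto> \<tau>(f g)\<close> on the
  polynomials of degree less than \<open>deg q\<close>. Modulo \<open>q\<close> the left-hand side is \<open>f r p\<close>, thus \<open>f\<close>, and
  the degree of \<open>b\<close> in \<open>x\<close> excludes any other polynomial in this residue class.\<close>

theorem map_bezout_poly:
  assumes kill: "\<And>g. \<tau> (q * g) = 0"
    and p: "map_poly \<tau> (difference_quotient q) = p"
    and rp: "[r * p = 1] (mod q)"
    and degrees: "degree r \<le> degree q" "degree f < degree q"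
  shows "map_poly \<tau> (in_y f * bezout_poly q r) = f"
proof (rule ccontr)
  assume neq: "map_poly \<tau> (in_y f * bezout_poly q r) \<noteq> f"
  let ?D = "map_poly \<tau> (difference_quotient (f * r))"
  have killed: "map_poly \<tau> (in_y q * P) = 0" for P
    by (rule poly_eqI) (simp add: coeff_map in_y_def kill)
  have "in_y f * bezout_poly q r
      = in_y (f * r) * difference_quotient q - in_y q * (in_y f * difference_quotient r)"
    by (simp only: bezout_poly_eq_difference_quotients[of q r] right_diff_distrib in_y_mult mult_ac)
  then have "map_poly \<tau> (in_y f * bezout_poly q r) = (f * r) * p - q * ?D"
    by (simp only: map_diff killed diff_zero map_difference_quotient_product[OF kill] p)
  moreover obtain h where h: "r * p - 1 = q * h"
    using rp by (auto simp: cong_iff_dvd_diff)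
  have "f * r * p = f * (r * p - 1) + f"
    by (simp add: right_diff_distrib mult.assoc)
  then have "f * r * p = f * (q * h) + f"
    by (simp only: h)
  ultimately have "map_poly \<tau> (in_y f * bezout_poly q r) - f = q * (f * h - ?D)"
    by (simp add: right_diff_distrib mult.left_commute)
  then have "q dvd map_poly \<tau> (in_y f * bezout_poly q r) - f"
    by (rule dvdI)
  then have "degree q \<le> degree (map_poly \<tau> (in_y f * bezout_poly q r) - f)"
    using neq by (intro dvd_imp_degree_le) auto
  moreover have "degree (map_poly \<tau> (in_y f * bezout_poly q r)) < degree q"
  proof -
    obtain m where m: "degree q = Suc m"
      using degrees(2) by (cases "degree q") auto
    have "degree (map_poly \<tau> (in_y f * bezout_poly q r)) \<le> degree (in_y f * bezout_poly q r)"
      by (rule map_poly_degree_leq)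
    also have "\<dots> \<le> degree (bezout_poly q r)"
      by (simp add: in_y_def degree_smult_le)
    also have "\<dots> \<le> m"
      using degrees m by (intro degree_bezout_poly) auto
    finally show ?thesis by (simp add: m)
  qed
  ultimately show False
    using degree_diff_less[OF _ degrees(2)] by (simp only: not_le[symmetric]) simp
qed

section \<open>Moments and expansion at infinity\<close>

lemma poly_at_infinity_pCons:
  "poly_at_infinity (pCons a f) = fls_const a + fls_X_inv * poly_at_infinity f"
  by (simp add: poly_at_infinity_def map_poly_pCons)

lemma poly_at_infinity_nth:
  "fls_nth (poly_at_infinity f) (- int i) = coeff f i" "n > 0 \<Longrightarrow> fls_nth (poly_at_infinity f) n = 0"
proof (induction f arbitrary: i n)
  case 0
  {
    case 1
    then show ?case by (simp add: poly_at_infinity_def)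
  next
    case 2
    then show ?case by (simp add: poly_at_infinity_def)
  }
next
  case (pCons a f)
  {
    case 1
    have shift: "1 - int (Suc j) = - int j" for j by simp
    then show ?case
      using pCons.IH(1) pCons.IH(2)[of 1]
      by (cases i)
        (simp_all add: poly_at_infinity_pCons fls_X_inv_times_conv_shift shift del: of_nat_Suc)
  next
    case 2
    then show ?case
      using pCons.IH(2)[of "n + 1"]
      by (simp add: poly_at_infinity_pCons fls_X_inv_times_conv_shift)
  }
qed

text \<open>For \<open>S = \<Sum>\<^sub>l \<tau>(y\<^sup>l) T\<^sup>-\<^sup>l\<^sup>-\<^sup>1\<close>, the coefficient of \<open>T\<^sup>i\<close> in \<open>f S\<close> is \<open>\<Sum>\<^sub>l f\<^sub>i\<^sub>+\<^sub>l\<^sub>+\<^sub>1 \<tau>(y\<^sup>l)\<close>, which is also the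
  coefficient of \<open>x\<^sup>i\<close> in \<open>\<tau>(D\<^sub>f)\<close>. Both sides obey the same recursion in \<open>f\<close>.\<close>

lemma moment_product_nth:
  fixes S :: "'k fls"
  assumes pos: "\<And>l. fls_nth S (int l + 1) = \<tau> (monom 1 l)"
    and nonpos: "\<And>n. n \<le> 0 \<Longrightarrow> fls_nth S n = 0"
  shows "fls_nth (S * poly_at_infinity f) (- int i) = coeff (map_poly \<tau> (difference_quotient f)) i"
proof -
  have nth: "fls_nth (S * poly_at_infinity (pCons a f)) n
      = a * fls_nth S n + fls_nth (S * poly_at_infinity f) (n + 1)" for a f n
  proof -
    have "S * poly_at_infinity (pCons a f)
        = fls_const a * S + fls_X_inv * (S * poly_at_infinity f)"
      by (simp add: poly_at_infinity_pCons algebra_simps)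
    then show ?thesis by (simp add: fls_X_inv_times_conv_shift)
  qed
  \<comment> \<open>In passing from \<open>f\<close> to \<open>a + T f\<close>, the constant coefficient of the product becomes
    the coefficient of \<open>T\<^sup>-\<^sup>1\<close> in \<open>f S\<close>, so the negative powers of \<open>T\<close> are needed too.\<close>
  have pos_part: "fls_nth (S * poly_at_infinity f) (int l + 1) = \<tau> (monom 1 l * f)" for l f
  proof (induction f arbitrary: l)
    case 0
    then show ?case by (simp add: poly_at_infinity_def zero)
  next
    case (pCons a f)
    have "monom 1 l * pCons a f = Polynomial.smult a (monom 1 l) + monom 1 (Suc l) * f"
      by (simp add: monom_Suc mult_pCons_right)
    then show ?case
      using pCons.IH[of "Suc l"] by (simp add: nth pos add smult)
  qed
  show "fls_nth (S * poly_at_infinity f) (- int i) = coeff (map_poly \<tau> (difference_quotient f)) i"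
  proof (induction f arbitrary: i)
    case 0
    have "difference_quotient (0 :: 'k poly) = 0"
      by (simp add: bezout_poly_def in_x_def in_y_def)
    then show ?case by (simp add: poly_at_infinity_def)
  next
    case (pCons a f)
    show ?case
    proof (cases i)
      case 0
      then show ?thesis
        using pos_part[of f 0]
        by (simp add: nth nonpos difference_quotient_pCons map_pCons)
    next
      case (Suc j)
      have "- int i + 1 = - int j" using Suc by simp
      then show ?thesis
        using pCons.IH[of j] Suc
        by (simp add: nth nonpos difference_quotient_pCons map_pCons)
    qed
  qed
qed

lemma numerator_eq_map_difference_quotient:
  fixes S :: "'k fls"
  assumes "\<And>l. fls_nth S (int l + 1) = \<tau> (monom 1 l)"
    and "\<And>n. n \<le> 0 \<Longrightarrow> fls_nth S n = 0"
    and S: "S = poly_at_infinity p / poly_at_infinity q" and q: "q \<noteq> 0"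
  shows "map_poly \<tau> (difference_quotient q) = p"
proof (rule poly_eqI)
  fix i
  have "fls_nth (poly_at_infinity q) (- int (degree q)) \<noteq> 0"
    using q by (simp add: poly_at_infinity_nth)
  then have "poly_at_infinity q \<noteq> 0" by auto
  then have "S * poly_at_infinity q = poly_at_infinity p" using S by simp
  then have "fls_nth (S * poly_at_infinity q) (- int i) = fls_nth (poly_at_infinity p) (- int i)" by simp
  then show "coeff (map_poly \<tau> (difference_quotient q)) i = coeff p i"
    by (simp only: moment_product_nth[OF assms(1,2)] poly_at_infinity_nth)
qed

end

section \<open>Evaluation at the generator\<close>

context monogenic_frobenius_algebra
begin

abbreviation eval where "eval \<equiv> eval_alg scale \<alpha>"

lemma scale_mult_right: "x * scale c y = scale c (x * y)"
  by (metis mult.commute scale_mult_left)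

lemma eval_upto:
  assumes "degree f \<le> n"
  shows "eval f = (\<Sum>i\<le>n. scale (coeff f i) (\<alpha> ^ i))"
  unfolding eval_alg_def
  by (rule sum.mono_neutral_left) (use assms in \<open>auto simp: coeff_eq_0\<close>)

lemma eval_pCons: "eval (pCons a f) = scale a 1 + \<alpha> * eval f"
proof -
  have "eval (pCons a f) = (\<Sum>i\<le>Suc (degree f). scale (coeff (pCons a f) i) (\<alpha> ^ i))"
    by (rule eval_upto) (rule degree_pCons_le)
  then show ?thesis
    by (simp only: sum.atMost_Suc_shift)
      (simp add: eval_alg_def sum_distrib_left scale_mult_right)
qed

lemma eval_0: "eval 0 = 0"
  by (simp add: eval_alg_def)

lemma eval_add: "eval (f + g) = eval f + eval g"
  using eval_upto[of f "max (degree f) (degree g)"] eval_upto[of g "max (degree f) (degree g)"]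
    eval_upto[OF degree_add_le_max, of f g]
  by (simp add: scale_left_distrib sum.distrib)

lemma eval_smult: "eval (Polynomial.smult c f) = scale c (eval f)"
  using eval_upto[OF degree_smult_le, of c f] eval_upto[of f "degree f"]
  by (simp add: scale_sum_right)

lemma eval_mult: "eval (f * g) = eval f * eval g"
  by (induction f)
    (simp_all add: eval_0 eval_pCons mult_pCons_left eval_add eval_smult ring_distribs
      scale_mult_left mult.assoc)

lemma eval_monom: "eval (monom c i) = scale c (\<alpha> ^ i)"
  by (induction i)
    (simp_all add: monom_0 monom_Suc eval_pCons eval_0 scale_mult_right)

text \<open>Minimality of the degree of \<open>q\<close> makes the powers below it independent; division by \<open>q\<close> makes
  them span. In particular \<open>deg q\<close> is the dimension.\<close>

lemma basis_family_powers:
  assumes q: "is_min_poly scale \<alpha> q"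
  shows "basis_family scale (degree q) (\<lambda>i. \<alpha> ^ i)"
proof -
  have lead: "lead_coeff q = 1" and root: "eval q = 0"
    and minimal: "\<And>f. f \<noteq> 0 \<Longrightarrow> eval f = 0 \<Longrightarrow> degree q \<le> degree f"
    using q by (auto simp: is_min_poly_def)
  have indep: "c i = 0"
    if zero: "(\<Sum>i<degree q. scale (c i) (\<alpha> ^ i)) = 0" and i: "i < degree q" for c i
  proof -
    let ?f = "\<Sum>i<degree q. monom (c i) i"
    have "eval (sum h I) = (\<Sum>i\<in>I. eval (h i))" for h and I :: "nat set"
      by (induction I rule: infinite_finite_induct) (simp_all add: eval_0 eval_add)
    then have "eval ?f = 0" using zero by (simp add: eval_monom)
    moreover have "degree ?f < degree q"
      using i by (intro degree_sum_less) (auto intro: le_less_trans[OF degree_monom_le])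
    ultimately have "?f = 0" using minimal[of ?f] by linarith
    then have "coeff ?f i = 0" by simp
    then show ?thesis using i by (simp add: coeff_sum)
  qed
  have inj: "inj_on (\<lambda>i. \<alpha> ^ i) {..<degree q}"
  proof (rule inj_onI, rule ccontr)
    fix i j assume ij: "i \<in> {..<degree q}" "j \<in> {..<degree q}" "\<alpha> ^ i = \<alpha> ^ j" "i \<noteq> j"
    let ?f = "monom 1 i - monom 1 j :: 'k poly"
    have "coeff ?f i \<noteq> 0" using ij by simp
    then have "?f \<noteq> 0" by (metis coeff_0)
    moreover have "eval ?f = 0"
      using eval_add[of ?f "monom 1 j"] ij by (simp add: eval_monom)
    moreover have "degree ?f < degree q"
      using ij by (intro degree_diff_less) (auto simp: degree_monom_eq)
    ultimately show False using minimal[of ?f] by linarith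
  qed
  have "independent ((\<lambda>i. \<alpha> ^ i) ` {..<degree q})"
  proof (rule independent_if_scalars_zero)
    fix u x
    assume sum: "(\<Sum>x\<in>(\<lambda>i. \<alpha> ^ i) ` {..<degree q}. scale (u x) x) = 0"
      and x: "x \<in> (\<lambda>i. \<alpha> ^ i) ` {..<degree q}"
    then obtain i where i: "x = \<alpha> ^ i" "i < degree q" by auto
    have "(\<Sum>i<degree q. scale (u (\<alpha> ^ i)) (\<alpha> ^ i)) = 0"
      using sum by (simp add: sum.reindex[OF inj])
    from indep[OF this i(2)] show "u x = 0" by (simp add: i)
  qed simp
  moreover have "span ((\<lambda>i. \<alpha> ^ i) ` {..<degree q}) = UNIV"
  proof (intro equalityI subset_UNIV subsetI)
    fix x
    obtain f where f: "x = eval f" using monogenic by (metis UNIV_I imageE)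
    have "eval f = eval (f div q * q + f mod q)" by simp
    also have "\<dots> = eval (f mod q)" by (simp only: eval_add eval_mult root) simp
    finally have x: "x = eval (f mod q)" by (simp add: f)
    have "q \<noteq> 0" using lead by auto
    then have "f mod q = 0 \<or> degree (f mod q) < degree q" by (rule degree_mod_less)
    then show "x \<in> span ((\<lambda>i. \<alpha> ^ i) ` {..<degree q})"
    proof
      assume "f mod q = 0"
      then show ?thesis by (simp add: x eval_0 span_zero)
    next
      assume "degree (f mod q) < degree q"
      then show ?thesis
        unfolding x eval_alg_def by (intro span_sum span_scale span_base) auto
    qed
  qed
  ultimately show ?thesis by (simp add: basis_family_def inj)
qed

lemma basis_family_dim:
  assumes "basis_family scale d e"
  shows "dim UNIV = d"
  using assms dim_eq_card[of "e ` {..<d}" UNIV]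
  by (simp add: basis_family_def card_image)

lemma t_add: "t (x + y) = t x + t y"
  and t_scale: "t (scale c x) = c * t x"
  and t_zero: "t 0 = 0"
  and t_diff: "t (x - y) = t x - t y"
  and t_sum: "t (sum h I) = (\<Sum>i\<in>I. t (h i))"
proof -
  interpret T: Vector_Spaces.linear scale "(*)" t by (fact linear_t)
  show "t (x + y) = t x + t y" "t (scale c x) = c * t x" "t 0 = 0" "t (x - y) = t x - t y"
    "t (sum h I) = (\<Sum>i\<in>I. t (h i))"
    by (simp_all add: T.add T.scale T.zero T.diff T.sum)
qed

sublocale functional: poly_functional "\<lambda>f. t (eval f)"
  by unfold_locales (simp_all add: eval_add eval_smult t_add t_scale)

section \<open>Dual bases\<close>

lemma dual_family_pairing:
  assumes "basis_family scale d e" "i < d" "j < d"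
  shows "t (e i * dual_family t d e j) = (if i = j then 1 else 0)"
  using theI'[OF ex1_dual[OF assms(1,3)]] assms(2) by (simp add: dual_family_def)

lemma dual_family_eqI:
  assumes "basis_family scale d e" "j < d"
    and "\<And>i. i < d \<Longrightarrow> t (e i * y) = (if i = j then 1 else 0)"
  shows "dual_family t d e j = y"
  unfolding dual_family_def
  by (rule the1_equality[OF ex1_dual[OF assms(1,2)]]) (use assms(3) in blast)

lemma expand_in_basis:
  assumes e: "basis_family scale d e"
  shows "x = (\<Sum>i<d. scale (t (x * dual_family t d e i)) (e i))"
proof -
  have "x \<in> span (e ` {..<d})" using e by (simp add: basis_family_def)
  then show ?thesis
  proof (induction rule: span_induct_alt)
    case base
    then show ?case by (simp add: t_zero)
  next
    case (step c y z)
    from step(1) obtain k where k: "y = e k" "k < d" by auto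
    have "(\<Sum>i<d. scale (t (e k * dual_family t d e i)) (e i)) = e k"
      using e k by (simp add: dual_family_pairing if_distrib[of "\<lambda>c. scale c _"] cong: if_cong)
    then have "(\<Sum>i<d. scale (t ((scale c y + z) * dual_family t d e i)) (e i)) = scale c y + z"
      using step(2)
      by (simp add: k ring_distribs t_add t_scale scale_mult_left scale_left_distrib sum.distrib
          flip: scale_scale scale_sum_right)
    then show ?case by simp
  qed
qed

text \<open>The difference of the two sides is orthogonal to every \<open>e\<^sub>i\<close>, hence zero by non-degeneracy.\<close>

lemma expand_in_dual_family:
  assumes e: "basis_family scale d e"
  shows "x = (\<Sum>i<d. scale (t (e i * x)) (dual_family t d e i))"
proof -
  let ?y = "\<Sum>i<d. scale (t (e i * x)) (dual_family t d e i)"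
  have orth: "t (e k * (x - ?y)) = 0" if "k < d" for k
  proof -
    have "t (e k * ?y) = t (e k * x)"
      using that e
      by (simp add: sum_distrib_left scale_mult_right t_sum t_scale dual_family_pairing
          if_distrib[of "\<lambda>c. _ * c"] cong: if_cong)
    then show ?thesis by (simp add: right_diff_distrib t_diff)
  qed
  have "x - ?y = 0"
  proof (rule nondegenerate)
    fix z
    have "(x - ?y) * z = (\<Sum>i<d. scale (t (z * dual_family t d e i)) (e i * (x - ?y)))"
      by (subst mult.commute, subst (1) expand_in_basis[OF e, of z])
        (simp only: sum_distrib_right scale_mult_left)
    then show "t ((x - ?y) * z) = 0"
      by (simp add: t_sum t_scale orth)
  qed
  then show ?thesis by simp
qed

end

section \<open>Congruence in the tensor square\<close>

interpretation free: vector_space free_scale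
  by (rule vector_space_free_scale)

definition tensor_cong ::
    "('k::field \<Rightarrow> 'a::comm_ring_1 \<Rightarrow> 'a) \<Rightarrow> (('a \<times> 'a) \<Rightarrow>\<^sub>0 'k) \<Rightarrow> (('a \<times> 'a) \<Rightarrow>\<^sub>0 'k) \<Rightarrow> bool" where
  "tensor_cong scale u v \<longleftrightarrow> u - v \<in> free.span (tensor_relations scale)"

lemma tensor_cong_refl: "tensor_cong scale u u"
  by (simp add: tensor_cong_def free.span_zero)

lemma tensor_cong_sym: "tensor_cong scale u v \<Longrightarrow> tensor_cong scale v u"
  unfolding tensor_cong_def using free.span_neg by fastforce

lemma tensor_cong_trans:
  "tensor_cong scale u v \<Longrightarrow> tensor_cong scale v w \<Longrightarrow> tensor_cong scale u w"
  unfolding tensor_cong_def using free.span_add by fastforce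

lemma tensor_cong_add:
  assumes "tensor_cong scale u v" "tensor_cong scale u' v'"
  shows "tensor_cong scale (u + u') (v + v')"
  using free.span_add[OF assms[unfolded tensor_cong_def]]
  by (simp add: tensor_cong_def algebra_simps)

lemma tensor_cong_sum:
  "(\<And>i. i \<in> I \<Longrightarrow> tensor_cong scale (g i) (h i)) \<Longrightarrow> tensor_cong scale (sum g I) (sum h I)"
  by (induction I rule: infinite_finite_induct) (auto intro: tensor_cong_refl tensor_cong_add)

lemma tensor_class_eqI:
  assumes "tensor_cong scale u v"
  shows "tensor_class scale u = tensor_class scale v"
proof -
  have "w - u \<in> free.span (tensor_relations scale) \<longleftrightarrow> w - v \<in> free.span (tensor_relations scale)"
    for w
    using tensor_cong_trans[of scale w u v] tensor_cong_trans[of scale w v u] assms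
      tensor_cong_sym[OF assms]
    by (auto simp: tensor_cong_def)
  then show ?thesis by (simp add: tensor_class_def)
qed

lemma tensor_cong_relation:
  "u - v - w \<in> tensor_relations scale \<Longrightarrow> tensor_cong scale u (v + w)"
  "u - v \<in> tensor_relations scale \<Longrightarrow> tensor_cong scale u v"
  by (simp_all add: tensor_cong_def free.span_base diff_diff_add[symmetric])

context monogenic_frobenius_algebra
begin

lemma tensor_expand_left:
  "tensor_cong scale (free_gen (\<Sum>i\<in>I. scale (c i) (x i)) b)
     (\<Sum>i\<in>I. free_scale (c i) (free_gen (x i) b))"
  and tensor_expand_right:
  "tensor_cong scale (free_gen b (\<Sum>i\<in>I. scale (c i) (x i)))
     (\<Sum>i\<in>I. free_scale (c i) (free_gen b (x i)))"
proof -
  \<comment> \<open>The relations have no clause for zero; it is covered by scaling with \<open>c = 0\<close>.\<close>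
  have zero: "tensor_cong scale (free_gen 0 b) 0" "tensor_cong scale (free_gen b 0) 0"
    using tensor_cong_relation(2)[OF tensor_relations.scale_left[where c = 0 and a = 0 and b = b and scale = scale]]
      tensor_cong_relation(2)[OF tensor_relations.scale_right[where c = 0 and a = b and b = 0 and scale = scale]]
    by simp_all
  show "tensor_cong scale (free_gen (\<Sum>i\<in>I. scale (c i) (x i)) b)
     (\<Sum>i\<in>I. free_scale (c i) (free_gen (x i) b))"
    by (induction I rule: infinite_finite_induct)
      (auto simp: zero
        intro!: tensor_cong_trans[OF tensor_cong_relation(1)[OF tensor_relations.add_left]]
          tensor_cong_add[OF tensor_cong_relation(2)[OF tensor_relations.scale_left]])
  show "tensor_cong scale (free_gen b (\<Sum>i\<in>I. scale (c i) (x i)))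
     (\<Sum>i\<in>I. free_scale (c i) (free_gen b (x i)))"
    by (induction I rule: infinite_finite_induct)
      (auto simp: zero
        intro!: tensor_cong_trans[OF tensor_cong_relation(1)[OF tensor_relations.add_right]]
          tensor_cong_add[OF tensor_cong_relation(2)[OF tensor_relations.scale_right]])
qed

text \<open>Expand \<open>e\<^sub>k\<close> in the basis \<open>f\<close>, and \<open>f'\<^sub>i\<close> in the dual basis \<open>e'\<close>: with the same coefficients
  \<open>\<langle>e\<^sub>k, f'\<^sub>i\<rangle>\<close>, both \<open>\<Sum>\<^sub>k e\<^sub>k \<otimes> e'\<^sub>k\<close> and \<open>\<Sum>\<^sub>i f\<^sub>i \<otimes> f'\<^sub>i\<close> become \<open>\<Sum>\<^sub>k\<^sub>,\<^sub>i \<langle>e\<^sub>k, f'\<^sub>i\<rangle> f\<^sub>i \<otimes> e'\<^sub>k\<close>.\<close>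

lemma casimir_basis_independent:
  assumes e: "basis_family scale d e" and f: "basis_family scale d f"
  shows "casimir scale t d e = casimir scale t d f"
  unfolding casimir_def
proof (rule tensor_class_eqI)
  let ?e' = "dual_family t d e" and ?f' = "dual_family t d f"
  let ?M = "\<Sum>k<d. \<Sum>i<d. free_scale (t (e k * ?f' i)) (free_gen (f i) (?e' k))"
  have left: "tensor_cong scale (\<Sum>k<d. free_gen (e k) (?e' k)) ?M"
  proof (rule tensor_cong_sum)
    fix k
    show "tensor_cong scale (free_gen (e k) (?e' k))
        (\<Sum>i<d. free_scale (t (e k * ?f' i)) (free_gen (f i) (?e' k)))"
      using tensor_expand_left[of "\<lambda>i. t (e k * ?f' i)" f "{..<d}" "?e' k"]
      by (simp only: expand_in_basis[OF f, of "e k", symmetric])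
  qed
  have right: "tensor_cong scale (\<Sum>i<d. free_gen (f i) (?f' i))
      (\<Sum>i<d. \<Sum>k<d. free_scale (t (e k * ?f' i)) (free_gen (f i) (?e' k)))"
  proof (rule tensor_cong_sum)
    fix i
    show "tensor_cong scale (free_gen (f i) (?f' i))
        (\<Sum>k<d. free_scale (t (e k * ?f' i)) (free_gen (f i) (?e' k)))"
      using tensor_expand_right[of "f i" "\<lambda>k. t (e k * ?f' i)" ?e' "{..<d}"]
      by (simp only: expand_in_dual_family[OF e, of "?f' i", symmetric])
  qed
  have swap: "(\<Sum>i<d. \<Sum>k<d. free_scale (t (e k * ?f' i)) (free_gen (f i) (?e' k))) = ?M"
    by (rule sum.swap)
  show "tensor_cong scale (\<Sum>k<d. free_gen (e k) (?e' k)) (\<Sum>i<d. free_gen (f i) (?f' i))"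
    by (rule tensor_cong_trans[OF left tensor_cong_sym[OF right[unfolded swap]]])
qed

section \<open>The Casimir element as a Bezoutian\<close>

lemma moment_series_nth:
  "fls_nth (moment_series t \<alpha>) (int l + 1) = t (eval (monom 1 l))"
  "n \<le> 0 \<Longrightarrow> fls_nth (moment_series t \<alpha>) n = 0"
  by (auto simp: moment_series_def eval_monom nat_add_distrib)

text \<open>The coefficient of \<open>x\<^sup>i\<close> in \<open>\<tau>(y\<^sup>j b)\<close> is \<open>t(\<alpha>\<^sup>j b\<^sub>i(\<alpha>))\<close>, and it equals the coefficient of \<open>x\<^sup>i\<close> in
  \<open>x\<^sup>j\<close> by the reproducing property of the Bezoutian \<open>b\<close>.\<close>

lemma dual_family_powers:
  assumes q: "is_min_poly scale \<alpha> q"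
    and S: "moment_series t \<alpha> = poly_at_infinity p / poly_at_infinity q"
    and r: "degree r \<le> degree q" "[r * p = 1] (mod q)"
    and i: "i < degree q"
  shows "dual_family t (degree q) (\<lambda>i. \<alpha> ^ i) i = eval (coeff (bezout_poly q r) i)"
proof (rule dual_family_eqI[OF basis_family_powers[OF q] i])
  fix j assume j: "j < degree q"
  have "q \<noteq> 0" "eval q = 0" using q by (auto simp: is_min_poly_def)
  then have kill: "t (eval (q * g)) = 0" for g
    by (simp add: eval_mult t_zero)
  have numerator: "map_poly (\<lambda>f. t (eval f)) (difference_quotient q) = p"
    by (rule functional.numerator_eq_map_difference_quotient[OF moment_series_nth S \<open>q \<noteq> 0\<close>])
  have "degree (monom 1 j :: 'k poly) < degree q"
    using j by (simp add: degree_monom_eq)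
  from functional.map_bezout_poly[OF kill numerator r(2,1) this]
  have "coeff (map_poly (\<lambda>f. t (eval f)) (in_y (monom 1 j) * bezout_poly q r)) i
      = coeff (monom 1 j) i"
    by (rule arg_cong)
  then show "t (\<alpha> ^ j * eval (coeff (bezout_poly q r) i)) = (if j = i then 1 else 0)"
    by (simp add: functional.coeff_map in_y_def eval_mult eval_monom)
qed

end

theorem theorem2p7:
  fixes scale :: "'k::field \<Rightarrow> 'a::comm_ring_1 \<Rightarrow> 'a"
    and \<alpha> :: 'a and t :: "'a \<Rightarrow> 'k" and d :: nat and p q r :: "'k poly"
  assumes "monogenic_frobenius_algebra scale \<alpha> t"
    and "vector_space.dim scale (UNIV :: 'a set) = d" and "d \<ge> 1"
    and "is_min_poly scale \<alpha> q"
    and "degree p < d" and "coprime p q"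
    and "moment_series t \<alpha> = poly_at_infinity p / poly_at_infinity q"
    and "degree r < d" and "[r * p = 1] (mod q)"
  shows "dual_gram t d (\<lambda>i. \<alpha> ^ i) = bezoutian q r \<and>
    (\<forall>e. basis_family scale d e \<longrightarrow>
      represents_tensor scale \<alpha> d (bezout_poly q r) (casimir scale t d e))"
proof -
  interpret monogenic_frobenius_algebra scale \<alpha> t by fact
  let ?P = "bezout_poly q r" and ?e = "\<lambda>i. \<alpha> ^ i"
  let ?e' = "dual_family t d ?e"
  have basis: "basis_family scale d ?e" and deg: "degree q = d"
    using basis_family_powers[OF assms(4)] basis_family_dim assms(2) by auto
  have P_deg: "degree ?P \<le> d - 1" "degree (coeff ?P i) \<le> d - 1" for i
    using assms(3,8) deg by (auto intro!: degree_bezout_poly degree_coeff_bezout_poly)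
  have dual: "?e' i = (\<Sum>j<d. scale (coeff (coeff ?P i) j) (\<alpha> ^ j))" if "i < d" for i
  proof -
    have "?e' i = eval (coeff ?P i)"
      using dual_family_powers[OF assms(4,7) _ assms(9), of i] that assms(8) deg by simp
    also have "\<dots> = (\<Sum>j\<le>d - 1. scale (coeff (coeff ?P i) j) (\<alpha> ^ j))"
      by (rule eval_upto) (rule P_deg)
    also have "{..d - 1} = {..<d}" using assms(3) by auto
    finally show ?thesis .
  qed
  \<comment> \<open>Pairing \<open>\<alpha>\<^sup>l\<close> with the \<open>j\<close>-th dual vector selects the coefficient at \<open>l = j\<close>.\<close>
  have "t (?e' i * ?e' j) = coeff (coeff ?P i) j" if "i < d" "j < d" for i j
  proof -
    have "t (?e' i * ?e' j) = (\<Sum>l<d. coeff (coeff ?P i) l * t (\<alpha> ^ l * ?e' j))"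
      by (subst dual[OF that(1)]) (simp add: sum_distrib_right scale_mult_left t_sum t_scale)
    then show ?thesis
      using that basis
      by (simp add: dual_family_pairing if_distrib[of "\<lambda>c. _ * c"] cong: if_cong)
  qed
  then have "dual_gram t d ?e = bezoutian q r"
    using assms(8) deg by (auto simp: dual_gram_def bezoutian_def Let_def max_def intro!: eq_matI)
  moreover have "represents_tensor scale \<alpha> d ?P (casimir scale t d e)"
    if "basis_family scale d e" for e
  proof -
    have "tensor_cong scale (\<Sum>i<d. free_gen (\<alpha> ^ i) (?e' i))
        (\<Sum>i<d. \<Sum>j<d. free_scale (coeff (coeff ?P i) j) (free_gen (\<alpha> ^ i) (\<alpha> ^ j)))"
      by (intro tensor_cong_sum) (simp add: dual tensor_expand_right)
    then have "casimir scale t d ?e = tensor_class scale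
        (\<Sum>i<d. \<Sum>j<d. free_scale (coeff (coeff ?P i) j) (free_gen (\<alpha> ^ i) (\<alpha> ^ j)))"
      unfolding casimir_def by (rule tensor_class_eqI)
    then show ?thesis
      using P_deg casimir_basis_independent[OF that basis] by (simp add: represents_tensor_def)
  qed
  ultimately show ?thesis by blast
qed

end
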